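(* Let $\mathcal{A}$ be an Alpay Algebra with states $X$, adjustments $A$, update rule $\phi$ and evaluation $\Psi : X\to E$. Assume that the evaluation poset $(E,\le)$ has no infinite ascending chain (for example, $E$ is well-ordered or has the ascending chain condition), and that there exists at least one state $x_0 \in X$. Then the iterative sequence $x_0, x_1, x_2, \ldots$ defined by $x_{\lambda+1} = x_\lambda + \phi(x_\lambda)$ must eventually reach a fixed point. In other words, there exists some finite $N$ such that $\phi(x_N) = 0$. Consequently, a stable state exists in $X$ (reachable from $x_0$).
   Context: An Alpay Algebra $\mathcal{A}$ consists of: a class (or set) $X$ of states; a set (or class) $A$ of adjustments with a distinguished neutral adjustment $0\in A$ and an addition $+$ on $A$; a state update operation $+ : X\times A\to X$; an update rule $\phi : X\to A$; a totally ordered set (or class) $(E,\le)$, possibly extended with a top element $\top$; and an evaluation function $\Psi : X\to E$. These satisfy the following axioms. (1) $(A,+,0)$ is a commutative monoid. (2) $x+0=x$ and $(x+a)+b = x+(a+b)$ for all $x\in X$, $a,b\in A$. (3) $\phi(x)\in A$ is a uniquely defined adjustment for every $x\in X$. (4) For every $x\in X$: if $\phi(x)\neq 0$ then $\Psi(x) < \Psi(x+\phi(x))$; if $\phi(x)=0$ then $\Psi(x+a)\le\Psi(x)$ for all $a\in A$. (5) If $\Psi(x)$ is a maximal element of $\Psi(X)\subseteq E$, then $\phi(x)=0$. Optionally, some state $x_0\in X$ is designated as an initial state. A state $x^*\in X$ is a fixed point if $\phi(x^* )=0$; fixed points correspond to the stable states of the system. A state is reachable from another if it is obtained from it by applying adjustments.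 *)

theory Defs
  imports "HOL-Algebra.Group"
begin

text \<open>
  The commutative monoid of adjustments is a \<^const>\<open>comm_monoid\<close> record, so the neutral
  adjustment \<open>0\<close> appears as \<open>\<one>\<^bsub>A\<^esub>\<close> and the sum \<open>a + b\<close> as \<open>a \<otimes>\<^bsub>A\<^esub> b\<close>.  The operation
  \<open>x \<lhd> a\<close> is the state update \<open>x + a\<close>.  The pair \<open>(E, leq)\<close> is a totally ordered set, with
  \<open>(u, v) \<in> leq\<close> meaning \<open>u \<le> v\<close> and \<open>(u, v) \<in> leq - Id\<close> meaning \<open>u < v\<close>; it may or may not
  have a top element.
\<close>

locale alpay_algebra =
  fixes X :: "'x set"
    and A :: "('a, 'm) monoid_scheme" (structure)
    and act :: "'x \<Rightarrow> 'a \<Rightarrow> 'x"  (infixl "\<lhd>" 65)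
    and \<phi> :: "'x \<Rightarrow> 'a"
    and E :: "'e set"
    and leq :: "'e rel"
    and \<Psi> :: "'x \<Rightarrow> 'e"
  assumes adjustments: "comm_monoid A"
    and evaluation_order: "linear_order_on E leq"
    and act_closed: "\<lbrakk>x \<in> X; a \<in> carrier A\<rbrakk> \<Longrightarrow> x \<lhd> a \<in> X"
    and eval_closed: "x \<in> X \<Longrightarrow> \<Psi> x \<in> E"
    and act_neutral: "x \<in> X \<Longrightarrow> x \<lhd> \<one> = x"
    and act_assoc: "\<lbrakk>x \<in> X; a \<in> carrier A; b \<in> carrier A\<rbrakk> \<Longrightarrow> (x \<lhd> a) \<lhd> b = x \<lhd> (a \<otimes> b)"
    and update_closed: "x \<in> X \<Longrightarrow> \<phi> x \<in> carrier A"
    and update_improves: "\<lbrakk>x \<in> X; \<phi> x \<noteq> \<one>\<rbrakk> \<Longrightarrow> (\<Psi> x, \<Psi> (x \<lhd> \<phi> x)) \<in> leq - Id"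
    and no_update_optimal:
      "\<lbrakk>x \<in> X; \<phi> x = \<one>; a \<in> carrier A\<rbrakk> \<Longrightarrow> (\<Psi> (x \<lhd> a), \<Psi> x) \<in> leq"
    and maximal_no_update:
      "\<lbrakk>x \<in> X; \<not> (\<exists>v \<in> \<Psi> ` X. (\<Psi> x, v) \<in> leq - Id)\<rbrakk> \<Longrightarrow> \<phi> x = \<one>"

definition no_infinite_ascending_chain :: "'e set \<Rightarrow> 'e rel \<Rightarrow> bool" where
  "no_infinite_ascending_chain E leq \<longleftrightarrow>
     \<not> (\<exists>c :: nat \<Rightarrow> 'e. \<forall>n. c n \<in> E \<and> (c n, c (Suc n)) \<in> leq - Id)"

definition fixed_point :: "'x set \<Rightarrow> ('a, 'm) monoid_scheme \<Rightarrow> ('x \<Rightarrow> 'a) \<Rightarrow> 'x \<Rightarrow> bool" where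
  "fixed_point X A \<phi> x \<longleftrightarrow> x \<in> X \<and> \<phi> x = \<one>\<^bsub>A\<^esub>"

primrec iterate :: "('x \<Rightarrow> 'a \<Rightarrow> 'x) \<Rightarrow> ('x \<Rightarrow> 'a) \<Rightarrow> 'x \<Rightarrow> nat \<Rightarrow> 'x" where
  "iterate act \<phi> x\<^sub>0 0 = x\<^sub>0"
| "iterate act \<phi> x\<^sub>0 (Suc n) = act (iterate act \<phi> x\<^sub>0 n) (\<phi> (iterate act \<phi> x\<^sub>0 n))"

inductive reachable :: "('a, 'm) monoid_scheme \<Rightarrow> ('x \<Rightarrow> 'a \<Rightarrow> 'x) \<Rightarrow> 'x \<Rightarrow> 'x \<Rightarrow> bool"
  for A :: "('a, 'm) monoid_scheme" and act :: "'x \<Rightarrow> 'a \<Rightarrow> 'x" and x :: 'x where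
  start: "reachable A act x x"
| adjust: "\<lbrakk>reachable A act x y; a \<in> carrier A\<rbrakk> \<Longrightarrow> reachable A act x (act y a)"

end

theory Submission
  imports Defs
begin

context alpay_algebra
begin

text \<open>As long as an iterate is not fixed, its update strictly raises \<open>\<Psi>\<close>. If
  no iterate were fixed, the values of \<open>\<Psi>\<close> along the orbit would form an infinite
  strictly ascending chain in \<open>E\<close>, which is excluded.
  \<open>ex_fixed_point_iterate\<close> carries this argument; \<open>reachable_iterate\<close>
  turns the fixed iterate into a reachable stable state.\<close>

lemma iterate_closed: "x \<in> X \<Longrightarrow> iterate act \<phi> x n \<in> X"
  by (induction n) (auto intro: act_closed update_closed)

lemma reachable_iterate: "x \<in> X \<Longrightarrow> reachable A act x (iterate act \<phi> x n)"
  by (induction n) (auto intro: reachable.intros update_closed iterate_closed)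

lemma ex_fixed_point_iterate:
  assumes "no_infinite_ascending_chain E leq" and "x \<in> X"
  shows "\<exists>n. fixed_point X A \<phi> (iterate act \<phi> x n)"
proof (rule ccontr)
  assume "\<nexists>n. fixed_point X A \<phi> (iterate act \<phi> x n)"
  \<comment> \<open>Iterates stay in \<open>X\<close>, so a nonzero adjustment is the only way to
    fail to be fixed.\<close>
  then have "\<phi> (iterate act \<phi> x n) \<noteq> \<one>" for n
    using iterate_closed[OF \<open>x \<in> X\<close>] by (auto simp: fixed_point_def)
  then have "(\<Psi> (iterate act \<phi> x n), \<Psi> (iterate act \<phi> x (Suc n))) \<in> leq - Id" for n
    using update_improves[OF iterate_closed[OF \<open>x \<in> X\<close>]] by simp
  moreover have "\<Psi> (iterate act \<phi> x n) \<in> E" for n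
    by (rule eval_closed[OF iterate_closed[OF \<open>x \<in> X\<close>]])
  ultimately show False
    using assms(1) unfolding no_infinite_ascending_chain_def
    \<comment> \<open>The forbidden chain is \<open>\<Psi>\<close> along the orbit;
      \<open>iterate\<close> stays folded so that the successor term keeps the shape
      \<open>c (Suc n)\<close>.\<close>
    by (auto dest: spec[of _ "\<lambda>n. \<Psi> (iterate act \<phi> x n)"] simp del: iterate.simps)
qed

end

theorem theorem1:
  fixes X :: "'x set"
    and A :: "('a, 'm) monoid_scheme"
    and act :: "'x \<Rightarrow> 'a \<Rightarrow> 'x"
    and \<phi> :: "'x \<Rightarrow> 'a"
    and E :: "'e set"
    and leq :: "'e rel"
    and \<Psi> :: "'x \<Rightarrow> 'e"
    and x\<^sub>0 :: 'x
  assumes "alpay_algebra X A act \<phi> E leq \<Psi>"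
    and "no_infinite_ascending_chain E leq"
    and "x\<^sub>0 \<in> X"
  shows "(\<exists>N. fixed_point X A \<phi> (iterate act \<phi> x\<^sub>0 N)) \<and>
         (\<exists>x. fixed_point X A \<phi> x \<and> reachable A act x\<^sub>0 x)"
proof -
  interpret alpay_algebra X A act \<phi> E leq \<Psi> by (rule assms(1))
  show ?thesis
    \<comment> \<open>The same fixed iterate witnesses both conjuncts.\<close>
    using ex_fixed_point_iterate[OF assms(2,3)] reachable_iterate[OF assms(3)] by blast
qed

end
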